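(* Let $F$ be any linearly ordered field and let $L=F((x))$ be the field of formal Laurent series in one variable $x$ over $F$, linearly ordered and equipped with its field-metric $d(f,g)=|f-g|$ and the induced $\beta$-structure. Then $L$ is a complete, first-countable $\beta$-space.
   Context: A $\beta$-space $(X,R,\beta)$ is a topological space $X$ together with a set $R$ (of radial values) and a function $\beta: X\times R\to\mathcal{P}(X)$ (the power set of $X$) such that: (1) $x\in\beta(x,r)$ for all $x\in X$, $r\in R$; (2) $\beta(x,r)$ is open for all $x\in X$, $r\in R$; (3) for any open set $U$ and any $z\in U$ there is a $t\in R$ with $\beta(z,t)\subseteq U$; (4) for any $r\in R$ there is an $s\in R$ such that for all $x,y\in X$, if $x\in\beta(y,s)$ then $\beta(y,s)\subseteq\beta(x,r)$. Elements of $L$ are formal series $\sum_{i=m}^\infty a_i x^i$ with $m\in\mathbb{Z}$, $a_i\in F$. The linear order on $L$ is determined by: a nonzero series whose lowest-order nonzero coefficient is $a_m$ is positive if and only if $a_m>0$ in $F$; $|f|=\max(f,-f)$. The induced $\beta$-structure on $L$ has $R=L^+$ (the positive elements of $L$), $\beta(f,r)=\{g\in L : |f-g|<r\}$, and the topology with basis all the sets $\beta(f,r)$. A sequence $(a_i)$ in a $\beta$-space is Cauchy if for all $r\in R$ there is $N$ with $a_m\in\beta(a_n,r)$ for all $n,m\ge N$; the space is complete if every Cauchy sequence converges to a point of it. *)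

theory Defs
  imports
    "HOL-Analysis.Analysis"
    "HOL-Computational_Algebra.Formal_Laurent_Series"
begin

definition beta_space :: "'a topology \<Rightarrow> 'r set \<Rightarrow> ('a \<Rightarrow> 'r \<Rightarrow> 'a set) \<Rightarrow> bool" where
  "beta_space X R \<beta> \<longleftrightarrow>
     (\<forall>x\<in>topspace X. \<forall>r\<in>R. x \<in> \<beta> x r) \<and>
     (\<forall>x\<in>topspace X. \<forall>r\<in>R. openin X (\<beta> x r)) \<and>
     (\<forall>U. openin X U \<longrightarrow> (\<forall>z\<in>U. \<exists>t\<in>R. \<beta> z t \<subseteq> U)) \<and>
     (\<forall>r\<in>R. \<exists>s\<in>R. \<forall>x\<in>topspace X. \<forall>y\<in>topspace X. x \<in> \<beta> y s \<longrightarrow> \<beta> y s \<subseteq> \<beta> x r)"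

definition beta_Cauchy :: "'r set \<Rightarrow> ('a \<Rightarrow> 'r \<Rightarrow> 'a set) \<Rightarrow> (nat \<Rightarrow> 'a) \<Rightarrow> bool" where
  "beta_Cauchy R \<beta> a \<longleftrightarrow> (\<forall>r\<in>R. \<exists>N. \<forall>m\<ge>N. \<forall>n\<ge>N. a m \<in> \<beta> (a n) r)"

definition beta_complete :: "'a topology \<Rightarrow> 'r set \<Rightarrow> ('a \<Rightarrow> 'r \<Rightarrow> 'a set) \<Rightarrow> bool" where
  "beta_complete X R \<beta> \<longleftrightarrow>
     (\<forall>a. range a \<subseteq> topspace X \<and> beta_Cauchy R \<beta> a
        \<longrightarrow> (\<exists>l\<in>topspace X. limitin X a l sequentially))"

definition field_metric :: "'a::linordered_field \<Rightarrow> 'a \<Rightarrow> 'a" where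
  "field_metric f g = \<bar>f - g\<bar>"

definition radii :: "'a::linordered_field set" where
  "radii = {r. 0 < r}"

definition field_beta :: "'a::linordered_field \<Rightarrow> 'a \<Rightarrow> 'a set" where
  "field_beta f r = {g. field_metric f g < r}"

definition field_topology :: "'a::linordered_field topology" where
  "field_topology = topology (arbitrary union_of (\<lambda>U. \<exists>f. \<exists>r\<in>radii. U = field_beta f r))"

text \<open>
  \<^const>\<open>topology\<close> is only meaningful on families satisfying \<^const>\<open>istopology\<close>; the next two
  lemmas show that the sets \<^term>\<open>field_beta f r\<close> really form a basis of \<^const>\<open>field_topology\<close>,
  and that its underlying space is the whole field.
\<close>

lemma openin_field_topology:
  "openin field_topology = arbitrary union_of (\<lambda>U. \<exists>f. \<exists>r\<in>radii. U = field_beta f r)"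
proof -
  let ?P = "\<lambda>U :: 'a set. \<exists>f. \<exists>r\<in>radii. U = field_beta f r"
  have "(arbitrary union_of ?P) (S \<inter> T)" if S: "?P S" and T: "?P T" for S T
  proof -
    obtain f r where S': "S = field_beta f r" using S by blast
    obtain g t where T': "T = field_beta g t" using T by blast
    have "\<exists>U. ?P U \<and> h \<in> U \<and> U \<subseteq> S \<inter> T" if h: "h \<in> S \<inter> T" for h
    proof -
      define s where "s = min (r - \<bar>f - h\<bar>) (t - \<bar>g - h\<bar>)"
      have s: "0 < s" "s \<le> r - \<bar>f - h\<bar>" "s \<le> t - \<bar>g - h\<bar>"
        using h by (auto simp: s_def S' T' field_beta_def field_metric_def)
      have "field_beta h s \<subseteq> S \<inter> T"
      proof
        fix k assume "k \<in> field_beta h s"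
        then have k: "\<bar>h - k\<bar> < s" by (simp add: field_beta_def field_metric_def)
        have "\<bar>f - k\<bar> \<le> \<bar>f - h\<bar> + \<bar>h - k\<bar>" "\<bar>g - k\<bar> \<le> \<bar>g - h\<bar> + \<bar>h - k\<bar>"
          using abs_triangle_ineq[of "f - h" "h - k"] abs_triangle_ineq[of "g - h" "h - k"] by simp_all
        with k s show "k \<in> S \<inter> T" by (auto simp: S' T' field_beta_def field_metric_def)
      qed
      moreover have "h \<in> field_beta h s" using s by (simp add: field_beta_def field_metric_def)
      moreover have "?P (field_beta h s)" using s by (auto simp: radii_def)
      ultimately show ?thesis by blast
    qed
    then show ?thesis by (auto simp: arbitrary_union_of_alt)
  qed
  then have "istopology (arbitrary union_of ?P)"
    by (simp add: istopology_base_eq)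
  then show ?thesis
    by (simp add: field_topology_def topology_inverse')
qed

lemma topspace_field_topology: "topspace field_topology = (UNIV :: 'a::linordered_field set)"
proof -
  have "openin field_topology (field_beta f (1::'a))" for f
    unfolding openin_field_topology
    by (rule arbitrary_union_of_inc) (use zero_less_one in \<open>unfold radii_def, blast\<close>)
  moreover have "f \<in> field_beta f 1" for f :: 'a
    by (simp add: field_beta_def field_metric_def)
  ultimately show ?thesis using openin_subset by blast
qed

text \<open>
  \<^term>\<open>fls_subdegree f\<close> is the lowest exponent with a nonzero coefficient when \<^term>\<open>f \<noteq> 0\<close>.
\<close>

definition fls_positive :: "'a::linordered_field fls \<Rightarrow> bool" where
  "fls_positive f \<longleftrightarrow> f \<noteq> 0 \<and> 0 < fls_nth f (fls_subdegree f)"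

lemma fls_positive_add:
  assumes "fls_positive f" "fls_positive g"
  shows "fls_positive (f + g)"
proof -
  let ?n = "min (fls_subdegree f) (fls_subdegree g)"
  have f: "0 \<le> fls_nth f ?n" "?n = fls_subdegree f \<Longrightarrow> 0 < fls_nth f ?n"
    using assms(1) unfolding fls_positive_def
    by (cases "fls_subdegree f \<le> fls_subdegree g"; force simp: min_def)+
  have g: "0 \<le> fls_nth g ?n" "?n = fls_subdegree g \<Longrightarrow> 0 < fls_nth g ?n"
    using assms(2) unfolding fls_positive_def
    by (cases "fls_subdegree g \<le> fls_subdegree f"; force simp: min_def)+
  have pos: "0 < fls_nth (f + g) ?n"
    using f g by (cases "fls_subdegree f \<le> fls_subdegree g") (auto simp: add_pos_nonneg add_nonneg_pos)
  moreover have "fls_subdegree (f + g) = ?n"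
    by (rule fls_subdegree_eqI) (use pos in auto)
  moreover have "f + g \<noteq> 0"
    using pos by (metis fls_zero_nth less_irrefl)
  ultimately show ?thesis by (simp add: fls_positive_def)
qed

lemma fls_positive_mult:
  assumes "fls_positive f" "fls_positive g"
  shows "fls_positive (f * g)"
  using assms by (auto simp: fls_positive_def)

lemma fls_positive_uminus: "fls_positive (- f) \<longleftrightarrow> f \<noteq> 0 \<and> \<not> fls_positive f"
  using nth_fls_subdegree_nonzero[of f] by (auto simp: fls_positive_def simp del: nth_fls_subdegree_nonzero)

instantiation fls :: (linordered_field) linorder
begin

definition less_fls :: "'a fls \<Rightarrow> 'a fls \<Rightarrow> bool" where
  "f < g \<longleftrightarrow> fls_positive (g - f)"

definition less_eq_fls :: "'a fls \<Rightarrow> 'a fls \<Rightarrow> bool" where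
  "(f :: 'a fls) \<le> g \<longleftrightarrow> f = g \<or> f < g"

instance
proof
  fix f g h :: "'a fls"
  have anti: "\<not> (f < g \<and> g < f)" for f g :: "'a fls"
    using fls_positive_uminus[of "g - f"] by (auto simp: less_fls_def)
  have irr: "\<not> f < f" for f :: "'a fls" by (simp add: less_fls_def fls_positive_def)
  have tr: "f < h" if "f < g" "g < h" for f g h :: "'a fls"
    using fls_positive_add[of "g - f" "h - g"] that by (simp add: less_fls_def)
  have tot: "f < g \<or> f = g \<or> g < f" for f g :: "'a fls"
    using fls_positive_uminus[of "g - f"] by (auto simp: less_fls_def)
  show "(f < g) = (f \<le> g \<and> \<not> g \<le> f)"
    using anti irr by (auto simp: less_eq_fls_def)
  show "f \<le> f" by (simp add: less_eq_fls_def)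
  show "f \<le> h" if "f \<le> g" "g \<le> h" using that tr by (auto simp: less_eq_fls_def)
  show "f = g" if "f \<le> g" "g \<le> f" using that anti by (auto simp: less_eq_fls_def)
  show "f \<le> g \<or> g \<le> f" using tot by (auto simp: less_eq_fls_def)
qed

end

instantiation fls :: (linordered_field) linordered_field
begin

definition abs_fls :: "'a fls \<Rightarrow> 'a fls" where
  "\<bar>f :: 'a fls\<bar> = max f (- f)"

definition sgn_fls :: "'a fls \<Rightarrow> 'a fls" where
  "sgn (f :: 'a fls) = (if f = 0 then 0 else if 0 < f then 1 else - 1)"

instance
proof
  fix f g h :: "'a fls"
  show "h + f \<le> h + g" if "f \<le> g" using that by (auto simp: less_eq_fls_def less_fls_def)
  show "h * f < h * g" if "f < g" "0 < h"
    using fls_positive_mult[of h "g - f"] that by (simp add: less_fls_def right_diff_distrib)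
  show "\<bar>f\<bar> = (if f < 0 then - f else f)"
  proof (cases f "0 :: 'a fls" rule: linorder_cases)
    case less
    then have "fls_positive (- f)" by (simp add: less_fls_def)
    from fls_positive_add[OF this this] have "f < - f" by (simp add: less_fls_def)
    with less show ?thesis by (simp add: abs_fls_def max_def)
  next
    case equal
    then show ?thesis by (simp add: abs_fls_def)
  next
    case greater
    then have "fls_positive f" by (simp add: less_fls_def)
    from fls_positive_add[OF this this] have "- f < f" by (simp add: less_fls_def)
    with greater show ?thesis by (auto simp: abs_fls_def max_def)
  qed
  show "sgn f = (if f = 0 then 0 else if 0 < f then 1 else - 1)" by (simp add: sgn_fls_def)
qed

end

end

theory Submission
  imports Defs
begin

text \<open>
  Two Laurent series are close in the order topology exactly when many of their low-order
  coefficients agree, so the powers of \<open>x\<close> are cofinal among the small positive radii. This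
  gives countable neighbourhood bases; in a Cauchy sequence each coefficient is eventually
  constant, and the series of these eventual values is the limit.
\<close>

lemma field_beta_self: "r \<in> radii \<Longrightarrow> x \<in> field_beta x r"
  by (simp add: field_beta_def field_metric_def radii_def)

lemma openin_field_beta: "r \<in> radii \<Longrightarrow> openin field_topology (field_beta x r)"
  unfolding openin_field_topology by (rule arbitrary_union_of_inc) blast

text \<open>An open set contains some basic ball around \<open>z\<close>, but that ball may be
  centred at another point \<open>f\<close>, so it has to be recentred at \<open>z\<close>.\<close>

lemma openin_field_topology_ball:
  assumes "openin field_topology U" "z \<in> U"
  shows "\<exists>t\<in>radii. field_beta z t \<subseteq> U"
proof -
  obtain f r where r: "r \<in> radii" "z \<in> field_beta f r" "field_beta f r \<subseteq> U"
    using assms unfolding openin_field_topology arbitrary_union_of_alt by blast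
  \<comment> \<open>The distance that \<open>z\<close> still has to the edge of the ball around
    \<open>f\<close>.\<close>
  have "r - \<bar>f - z\<bar> \<in> radii"
    using r by (simp add: field_beta_def field_metric_def radii_def)
  moreover have "field_beta z (r - \<bar>f - z\<bar>) \<subseteq> field_beta f r"
  proof
    fix k assume "k \<in> field_beta z (r - \<bar>f - z\<bar>)"
    then show "k \<in> field_beta f r"
      using abs_triangle_ineq[of "f - z" "z - k"] by (simp add: field_beta_def field_metric_def)
  qed
  ultimately show ?thesis using r(3) by blast
qed

text \<open>Triangle inequality through \<open>y\<close>; this supplies the radius
  \<open>r / 2\<close> for the last \<open>beta_space\<close> axiom.\<close>

lemma field_beta_half:
  assumes "x \<in> field_beta y (r / 2)"
  shows "field_beta y (r / 2) \<subseteq> field_beta x r"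
proof
  fix k assume k: "k \<in> field_beta y (r / 2)"
  have "\<bar>x - k\<bar> \<le> \<bar>y - x\<bar> + \<bar>y - k\<bar>"
    using abs_triangle_ineq[of "x - y" "y - k"] by (simp add: abs_minus_commute)
  also have "\<dots> < r / 2 + r / 2"
    using assms k by (intro add_strict_mono) (simp_all add: field_beta_def field_metric_def)
  finally show "k \<in> field_beta x r" by (simp add: field_beta_def field_metric_def)
qed

lemma beta_space_field: "beta_space field_topology radii field_beta"
  unfolding beta_space_def
proof (intro conjI)
  show "\<forall>r\<in>radii. \<exists>s\<in>radii. \<forall>x\<in>topspace field_topology. \<forall>y\<in>topspace field_topology.
          (x :: 'a) \<in> field_beta y s \<longrightarrow> field_beta y s \<subseteq> field_beta x r"
  proof
    fix r :: 'a assume "r \<in> radii"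
    then have "r / 2 \<in> radii" by (simp add: radii_def)
    then show "\<exists>s\<in>radii. \<forall>x\<in>topspace field_topology. \<forall>y\<in>topspace field_topology.
          (x :: 'a) \<in> field_beta y s \<longrightarrow> field_beta y s \<subseteq> field_beta x r"
      using field_beta_half by blast
  qed
qed (simp_all add: field_beta_self openin_field_beta openin_field_topology_ball)

text \<open>\<open>r - h\<close> has the same leading term as \<open>r\<close>, so it is positive.
  The hypothesis speaks of coefficients because \<open>fls_subdegree 0 = 0\<close> would make a
  bound on the order of \<open>h\<close> fail for \<open>h = 0\<close>.\<close>

lemma fls_less_if_low_nth_eq_0:
  fixes h r :: "'a::linordered_field fls"
  assumes r: "0 < r" and h: "\<And>j. j \<le> fls_subdegree r \<Longrightarrow> fls_nth h j = 0"
  shows "h < r"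
proof -
  have pos: "0 < fls_nth (r - h) (fls_subdegree r)"
    using r h by (simp add: less_fls_def fls_positive_def)
  moreover have "fls_subdegree (r - h) = fls_subdegree r"
    by (rule fls_subdegree_eqI) (use pos h in auto)
  moreover have "r - h \<noteq> 0"
    using pos by (metis fls_zero_nth less_irrefl)
  ultimately show ?thesis by (simp add: less_fls_def fls_positive_def)
qed

lemma fls_abs_less_if_low_nth_eq_0:
  fixes h r :: "'a::linordered_field fls"
  assumes "0 < r" "\<And>j. j \<le> fls_subdegree r \<Longrightarrow> fls_nth h j = 0"
  shows "\<bar>h\<bar> < r"
  using assms by (simp add: abs_less_iff fls_less_if_low_nth_eq_0)

lemma fls_X_power_pos: "0 < (fls_X ^ n :: 'a::linordered_field fls)"
  by (rule zero_less_power) (simp add: less_fls_def fls_positive_def)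

text \<open>A nonzero coefficient below \<open>n\<close> would give \<bar>h\<bar> an order below
  \<open>n\<close>, hence make it exceed \<open>fls_X ^ n\<close>.\<close>

lemma nth_eq_0_if_abs_less_X_power:
  fixes h :: "'a::linordered_field fls"
  assumes h: "\<bar>h\<bar> < fls_X ^ n" and j: "j < int n"
  shows "fls_nth h j = 0"
proof (rule ccontr)
  assume nz: "fls_nth h j \<noteq> 0"
  have "fls_subdegree \<bar>h\<bar> = fls_subdegree h" by (simp add: abs_if)
  also have "\<dots> \<le> j" using nz by (rule fls_subdegree_leI)
  finally have "fls_X ^ n < \<bar>h\<bar>"
    using nz j by (subst fls_less_if_low_nth_eq_0) auto
  with h show False by simp
qed

text \<open>The exponent exceeds the order of \<open>r\<close>; if that order is negative,
  \<open>nat\<close> yields exponent 0, which still exceeds it.\<close>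

lemma fls_X_power_less:
  fixes r :: "'a::linordered_field fls"
  assumes "0 < r"
  shows "fls_X ^ nat (fls_subdegree r + 1) < r"
  using assms by (subst fls_less_if_low_nth_eq_0) auto

lemma first_countable_fls: "first_countable (field_topology :: 'a::linordered_field fls topology)"
  unfolding first_countable_def
proof
  fix x :: "'a fls"
  let ?B = "range (\<lambda>n. field_beta x (fls_X ^ n))"
  have rad: "fls_X ^ n \<in> (radii :: 'a fls set)" for n
    by (simp add: radii_def fls_X_power_pos)
  have "\<exists>V\<in>?B. x \<in> V \<and> V \<subseteq> U" if U: "openin field_topology U" "x \<in> U" for U
  proof -
    obtain t where t: "t \<in> radii" "field_beta x t \<subseteq> U"
      using openin_field_topology_ball[OF U] by blast
    then have "field_beta x (fls_X ^ nat (fls_subdegree t + 1)) \<subseteq> U"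
      using fls_X_power_less[of t] by (force simp: field_beta_def radii_def)
    then show ?thesis using field_beta_self[OF rad] by blast
  qed
  moreover have "\<forall>V\<in>?B. openin field_topology V"
    using openin_field_beta[OF rad] by blast
  ultimately show "\<exists>\<B>. countable \<B> \<and> (\<forall>V\<in>\<B>. openin field_topology V) \<and>
      (\<forall>U. openin field_topology U \<and> x \<in> U \<longrightarrow> (\<exists>V\<in>\<B>. x \<in> V \<and> V \<subseteq> U))"
    by (intro exI[of _ ?B]) blast
qed

lemma beta_complete_fls:
  "beta_complete (field_topology :: 'a::linordered_field fls topology) radii field_beta"
  unfolding beta_complete_def
proof (intro allI impI, elim conjE)
  fix a :: "nat \<Rightarrow> 'a fls"
  assume Cauchy: "beta_Cauchy radii field_beta a"
  have "\<exists>N. \<forall>m\<ge>N. \<forall>n\<ge>N. \<bar>a n - a m\<bar> < fls_X ^ k" for k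
    using Cauchy fls_X_power_pos[of k]
    unfolding beta_Cauchy_def radii_def field_beta_def field_metric_def by blast
  then have "\<exists>N. \<forall>k. \<forall>m\<ge>N k. \<forall>n\<ge>N k. \<bar>a n - a m\<bar> < fls_X ^ k"
    by (intro choice allI)
  then obtain N where N: "\<And>k m n. m \<ge> N k \<Longrightarrow> n \<ge> N k \<Longrightarrow> \<bar>a n - a m\<bar> < fls_X ^ k"
    by blast
  \<comment> \<open>From index \<open>N k\<close> on, all coefficients below \<open>k\<close> are
    frozen.\<close>
  have stable: "fls_nth (a n) j = fls_nth (a m) j"
    if "m \<ge> N k" "n \<ge> N k" "j < int k" for m n k j
    using nth_eq_0_if_abs_less_X_power[OF N[OF that(1,2)] that(3)] by simp
  \<comment> \<open>The index \<open>N (nat (j + 1))\<close> is the same for all \<open>j < 0\<close>, so \<open>l\<close> has finite principal part.\<close>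
  define l where "l = Abs_fls (\<lambda>j. fls_nth (a (N (nat (j + 1)))) j)"
  have nth_l: "fls_nth l j = fls_nth (a (N (nat (j + 1)))) j" for j
    unfolding l_def
    \<comment> \<open>The \<open>min 0\<close> forces \<open>j < 0\<close>, where
      \<open>nat (j + 1) = 0\<close>.\<close>
    by (rule nth_Abs_fls_lower_bound[of "min 0 (fls_subdegree (a (N 0)))"]) simp
  have nth_limit: "fls_nth (a m) j = fls_nth l j" if m: "m \<ge> N k" and j: "j < int k" for m j k
  proof -
    \<comment> \<open>\<open>N\<close> need not be monotone, so both indices are compared with
      \<open>?M\<close>, which lies past both thresholds.\<close>
    let ?k = "nat (j + 1)" and ?M = "max (N k) (N (nat (j + 1)))"
    have "fls_nth (a m) j = fls_nth (a ?M) j"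
      using stable[of k ?M m j] m j by simp
    also have "\<dots> = fls_nth (a (N ?k)) j"
      using stable[of ?k "N ?k" ?M j] by simp
    finally show ?thesis by (simp add: nth_l)
  qed
  have "\<forall>\<^sub>F m in sequentially. a m \<in> U" if U: "openin field_topology U" "l \<in> U" for U
  proof -
    obtain t where t: "t \<in> radii" "field_beta l t \<subseteq> U"
      using openin_field_topology_ball[OF U] by blast
    \<comment> \<open>The \<open>+ 1\<close> makes \<open>a m\<close> and \<open>l\<close> agree
      also at the order of \<open>t\<close> itself.\<close>
    have "a m \<in> U" if m: "m \<ge> N (nat (fls_subdegree t + 1))" for m
    proof -
      have "\<bar>l - a m\<bar> < t"
        using t(1) by (subst fls_abs_less_if_low_nth_eq_0) (auto simp: radii_def nth_limit[OF m])
      then show ?thesis using t(2) by (auto simp: field_beta_def field_metric_def)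
    qed
    then show ?thesis by (rule eventually_sequentiallyI)
  qed
  then show "\<exists>l\<in>topspace field_topology. limitin field_topology a l sequentially"
    by (auto simp: limitin_def topspace_field_topology)
qed

theorem theorem1p9:
  shows "beta_space (field_topology :: 'F::linordered_field fls topology) radii field_beta
       \<and> beta_complete (field_topology :: 'F fls topology) radii field_beta
       \<and> first_countable (field_topology :: 'F fls topology)"
  by (simp add: beta_space_field beta_complete_fls first_countable_fls)

end
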